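(* Let $G$ be a conference graph of order $v$. Then every vertex $u$ of $G$ satisfies $$\mathcal{E}_S(u)=\frac{v-1}{\sqrt{v}}.$$
   Context: All graphs are finite, simple and undirected. A graph is strongly regular with parameters $(v,k,\lambda,\mu)$ if it has $v$ vertices, is $k$-regular, every pair of adjacent vertices has exactly $\lambda$ common neighbors, and every pair of distinct non-adjacent vertices has exactly $\mu$ common neighbors. A conference graph of order $v$ is a strongly regular graph with parameters $\left(v,\frac{v-1}{2},\frac{v-5}{4},\frac{v-1}{4}\right)$. The Seidel matrix of a graph $G$ with vertex set $\{u_1,\dots,u_n\}$ is the real symmetric $n\times n$ matrix $S(G)=[s_{ij}]$ with $s_{ii}=0$, and for $i\neq j$, $s_{ij}=-1$ if $u_i$ and $u_j$ are adjacent and $s_{ij}=1$ otherwise. For a real symmetric matrix $S$, $|S|=(S^2)^{1/2}$ is the positive semidefinite square root of $S^2$. The vertex Seidel energy of $u_i$ is $\mathcal{E}_S(u_i)=|S(G)|_{ii}$, the $i$-th diagonal entry of $|S(G)|$. *)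

theory Defs
  imports "HOL-Analysis.Analysis"
begin

text \<open>
  A graph is given by its adjacency relation on a finite vertex type, so that the vertices
  themselves index the rows and columns of its matrices.
\<close>

definition simple_graph :: "('v::finite \<Rightarrow> 'v \<Rightarrow> bool) \<Rightarrow> bool" where
  "simple_graph adj \<longleftrightarrow> symp adj \<and> irreflp adj"

definition neighbors :: "('v::finite \<Rightarrow> 'v \<Rightarrow> bool) \<Rightarrow> 'v \<Rightarrow> 'v set" where
  "neighbors adj x = {w. adj x w}"

text \<open>
  The parameters \<open>k\<close>, \<open>l\<close>, \<open>m\<close> are real numbers, so that fractions such as \<open>(v - 5) / 4\<close>
  can be supplied without truncation; cardinalities force them to be natural numbers
  except where the corresponding condition is vacuous.
\<close>

definition strongly_regular ::
    "('v::finite \<Rightarrow> 'v \<Rightarrow> bool) \<Rightarrow> nat \<Rightarrow> real \<Rightarrow> real \<Rightarrow> real \<Rightarrow> bool" where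
  "strongly_regular adj v k l m \<longleftrightarrow>
     simple_graph adj \<and>
     CARD('v) = v \<and>
     (\<forall>x. real (card (neighbors adj x)) = k) \<and>
     (\<forall>x y. adj x y \<longrightarrow> real (card (neighbors adj x \<inter> neighbors adj y)) = l) \<and>
     (\<forall>x y. x \<noteq> y \<and> \<not> adj x y \<longrightarrow>
        real (card (neighbors adj x \<inter> neighbors adj y)) = m)"

definition conference_graph :: "('v::finite \<Rightarrow> 'v \<Rightarrow> bool) \<Rightarrow> nat \<Rightarrow> bool" where
  "conference_graph adj v \<longleftrightarrow>
     strongly_regular adj v ((real v - 1) / 2) ((real v - 5) / 4) ((real v - 1) / 4)"

definition seidel_matrix :: "('v::finite \<Rightarrow> 'v \<Rightarrow> bool) \<Rightarrow> real ^ 'v ^ 'v" where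
  "seidel_matrix adj = (\<chi> x y. if x = y then 0 else if adj x y then -1 else 1)"

definition pos_semidef :: "real ^ 'n ^ 'n \<Rightarrow> bool" where
  "pos_semidef A \<longleftrightarrow> transpose A = A \<and> (\<forall>x. 0 \<le> x \<bullet> (A *v x))"

text \<open>
  For symmetric \<open>S\<close> the matrix \<open>S ** S\<close> is positive semidefinite, hence by the spectral theorem
  it has exactly one positive semidefinite square root. No meaning is intended for other \<open>S\<close>.
\<close>

definition matrix_abs :: "real ^ 'n ^ 'n \<Rightarrow> real ^ 'n ^ 'n" where
  "matrix_abs S = (THE P. pos_semidef P \<and> P ** P = S ** S)"

definition vertex_seidel_energy :: "('v::finite \<Rightarrow> 'v \<Rightarrow> bool) \<Rightarrow> 'v \<Rightarrow> real" where
  "vertex_seidel_energy adj u = matrix_abs (seidel_matrix adj) $ u $ u"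

end

theory Submission
  imports Defs
begin

text \<open>
  The parameters of a conference graph say that \<open>S\<^sup>2 = v I - J\<close>, where \<open>J\<close> is the all-ones matrix.
  As \<open>J\<^sup>2 = v J\<close>, the matrix \<open>v I - J\<close> is \<open>v\<close> times an orthogonal projection, so its positive
  semidefinite square root is \<open>(v I - J) / \<surd>v\<close>, whose diagonal entries are \<open>(v - 1) / \<surd>v\<close>.
\<close>

lemma symmetric_inner_matrix_vector:
  fixes P :: "real^'n^'n"
  assumes "transpose P = P"
  shows "x \<bullet> (P *v y) = (P *v x) \<bullet> y"
  by (metis assms dot_lmul_matrix transpose_matrix_vector)

text \<open>If \<open>z = P *v y\<close> were nonzero, moving from \<open>y\<close> a little against
  \<open>z\<close> would make the quadratic form negative: its linear term there is
  \<open>2 * t * (z \<bullet> z)\<close>.\<close>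

lemma pos_semidef_isotropic_imp_kernel:
  fixes P :: "real^'n^'n"
  assumes P: "pos_semidef P" and y: "y \<bullet> (P *v y) = 0"
  shows "P *v y = 0"
proof (rule ccontr)
  assume ne: "P *v y \<noteq> 0"
  define z where "z = P *v y"
  define a where "a = z \<bullet> (P *v z)"
  \<comment> \<open>The minimiser would be \<open>- (z \<bullet> z) / a\<close>; the denominator
    \<open>1 + a\<close> also covers \<open>a = 0\<close> and still gives a negative value.\<close>
  define t where "t = - (z \<bullet> z) / (1 + a)"
  have a: "a \<ge> 0" and zz: "z \<bullet> z > 0"
    using P ne by (auto simp: a_def z_def pos_semidef_def)
  have "y \<bullet> (P *v z) = z \<bullet> z"
    using P symmetric_inner_matrix_vector[of P y z] by (simp add: pos_semidef_def z_def)
  then have "(y + t *\<^sub>R z) \<bullet> (P *v (y + t *\<^sub>R z)) = 2 * t * (z \<bullet> z) + t^2 * a"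
    using y by (simp add: matrix_vector_right_distrib matrix_vector_mult_scaleR inner_add
        a_def power2_eq_square inner_commute algebra_simps flip: z_def)
  moreover have "0 \<le> (y + t *\<^sub>R z) \<bullet> (P *v (y + t *\<^sub>R z))"
    using P by (simp add: pos_semidef_def)
  moreover have "2 * t * (z \<bullet> z) + t^2 * a = - ((z \<bullet> z)^2 * (2 + a) / (1 + a)^2)"
    using a by (simp add: t_def power2_eq_square divide_simps) (simp add: algebra_simps)
  moreover have "(z \<bullet> z)^2 * (2 + a) / (1 + a)^2 > 0"
    using a zz by (simp add: zero_less_divide_iff)
  ultimately show False
    by linarith
qed

text \<open>Commutation gives \<open>(P + Q) ** (P - Q) = 0\<close>. So on the range of
  \<open>P - Q\<close> the two nonnegative forms add up to zero, and both matrices vanish there.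
  Then \<open>P - Q\<close> is symmetric with square zero, hence zero.\<close>

lemma pos_semidef_sqrt_unique_of_commute:
  fixes P Q :: "real^'n^'n"
  assumes P: "pos_semidef P" and Q: "pos_semidef Q"
    and comm: "P ** Q = Q ** P" and eq: "P ** P = Q ** Q"
  shows "P = Q"
proof -
  have "(P - Q) *v x = 0" for x
  proof -
    define y where "y = (P - Q) *v x"
    have "P *v y + Q *v y = 0"
      using comm eq by (simp add: y_def matrix_vector_mult_diff_rdistrib matrix_vector_mult_diff_distrib
          matrix_vector_mul_assoc)
    then have "y \<bullet> (P *v y) + y \<bullet> (Q *v y) = 0"
      by (simp flip: inner_add_right)
    then have "y \<bullet> (P *v y) = 0" "y \<bullet> (Q *v y) = 0"
      using P Q by (auto simp: pos_semidef_def add_nonneg_eq_0_iff)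
    then have "(P - Q) *v y = 0"
      using P Q by (simp add: pos_semidef_isotropic_imp_kernel matrix_vector_mult_diff_rdistrib)
    moreover have "transpose (P - Q) = P - Q"
      using P Q by (simp add: pos_semidef_def transpose_def vec_eq_iff)
    ultimately have "y \<bullet> y = 0"
      using symmetric_inner_matrix_vector[of "P - Q" y x] by (simp flip: y_def)
    then show ?thesis by (simp add: y_def)
  qed
  then show ?thesis by (simp add: matrix_eq matrix_vector_mult_diff_rdistrib)
qed

text \<open>Any root \<open>Q\<close> commutes with its own square \<open>S ** S\<close>, so
  \<open>comm\<close> reduces uniqueness to the commuting case and no spectral theorem is
  needed.\<close>

lemma matrix_abs_eqI:
  fixes P S :: "real^'n^'n"
  assumes P: "pos_semidef P" and PP: "P ** P = S ** S"
    and comm: "\<And>Q. Q ** (S ** S) = (S ** S) ** Q \<Longrightarrow> Q ** P = P ** Q"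
  shows "matrix_abs S = P"
  unfolding matrix_abs_def
proof (rule the_equality)
  fix Q assume Q: "pos_semidef Q \<and> Q ** Q = S ** S"
  then have "Q ** (S ** S) = (S ** S) ** Q"
    by (metis matrix_mul_assoc)
  with Q show "Q = P"
    by (metis comm P PP pos_semidef_sqrt_unique_of_commute)
qed (use P PP in simp)

lemma conference_seidel_square:
  fixes adj :: "'v::finite \<Rightarrow> 'v \<Rightarrow> bool"
  assumes "conference_graph adj v"
  shows "seidel_matrix adj ** seidel_matrix adj = (\<chi> x y. real v * of_bool (x = y) - 1)"
proof -
  from assms have sym: "adj x y \<longleftrightarrow> adj y x" and irr: "\<not> adj x x"
    and card: "CARD('v) = v" and k: "real (card (neighbors adj x)) = (real v - 1) / 2"
    and l: "adj x y \<Longrightarrow> real (card (neighbors adj x \<inter> neighbors adj y)) = (real v - 5) / 4"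
    and m: "x \<noteq> y \<Longrightarrow> \<not> adj x y \<Longrightarrow>
       real (card (neighbors adj x \<inter> neighbors adj y)) = (real v - 1) / 4" for x y
    unfolding conference_graph_def strongly_regular_def simple_graph_def
    by (auto dest: sympD irreflpD)
  have "(\<Sum>z\<in>UNIV. seidel_matrix adj $ x $ z * seidel_matrix adj $ z $ y)
      = real v * of_bool (x = y) - 1" for x y
  proof -
    let ?c = "real (card (neighbors adj x \<inter> neighbors adj y))"
    have deg: "(\<Sum>z\<in>UNIV. of_bool (adj w z)) = (real v - 1) / 2" for w
      using k[of w] by (simp add: neighbors_def)
    have common: "(\<Sum>z\<in>UNIV. of_bool (adj x z \<and> adj y z)) = ?c"
      by (simp add: neighbors_def Collect_conj_eq)
    \<comment> \<open>Each entry is \<open>1 - of_bool (z = x) - 2 * of_bool (adj x z)\<close>, and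
      likewise for \<open>y\<close>. Multiplied out, every term sums to a constant, a degree or the
      common neighbour count.\<close>
    have "seidel_matrix adj $ x $ z * seidel_matrix adj $ z $ y
        = 1 - of_bool (z = x) - of_bool (z = y) + of_bool (z = x) * of_bool (x = y)
          + 2 * (of_bool (z = x) * of_bool (adj x y)) + 2 * (of_bool (z = y) * of_bool (adj x y))
          - 2 * of_bool (adj x z) - 2 * of_bool (adj y z) + 4 * of_bool (adj x z \<and> adj y z)" for z
      using sym[of y z] sym[of x y] sym[of x z] irr by (auto simp: seidel_matrix_def)
    then have "(\<Sum>z\<in>UNIV. seidel_matrix adj $ x $ z * seidel_matrix adj $ z $ y)
        = real v - 2 + of_bool (x = y) + 4 * of_bool (adj x y) - 2 * (real v - 1) + 4 * ?c"
      by (simp add: sum.distrib sum_subtractf deg common card flip: sum_distrib_left sum_distrib_right)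
    \<comment> \<open>For \<open>x = y\<close> the count \<open>?c\<close> is the degree; the other
      two cases use the two common neighbour parameters, and both give \<open>-1\<close>.\<close>
    then show ?thesis
      using k[of x] l[of x y] m[of x y] irr by (cases "x = y"; cases "adj x y") (auto simp: field_simps)
  qed
  then show ?thesis by (simp add: matrix_matrix_mult_def)
qed

text \<open>By symmetry, \<open>c\<close> times the quadratic form at \<open>x\<close> is the
  squared norm of \<open>M *v x\<close>.\<close>

lemma pos_semidef_if_square_eq_scaleR:
  fixes M :: "real^'n^'n"
  assumes "transpose M = M" and "M ** M = c *\<^sub>R M" and "c > 0"
  shows "pos_semidef M"
proof -
  have "c * (x \<bullet> (M *v x)) = (M *v x) \<bullet> (M *v x)" for x
    using symmetric_inner_matrix_vector[OF assms(1), of x "M *v x"] assms(2)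
    by (simp add: matrix_vector_mul_assoc scaleR_matrix_vector_assoc[symmetric])
  then have "0 \<le> x \<bullet> (M *v x)" for x
    using \<open>c > 0\<close> by (metis inner_ge_zero zero_le_mult_iff not_less)
  with assms(1) show ?thesis by (simp add: pos_semidef_def)
qed

theorem mainTheorem4:
  fixes adj :: "'v::finite \<Rightarrow> 'v \<Rightarrow> bool" and v :: nat
  assumes "conference_graph adj v"
  shows "\<forall>u. vertex_seidel_energy adj u = (real v - 1) / sqrt (real v)"
proof -
  define M :: "real^'v^'v" where "M = (\<chi> x y. real v * of_bool (x = y) - 1)"
  define P where "P = (1 / sqrt v) *\<^sub>R M"
  have card: "CARD('v) = v"
    using assms by (simp add: conference_graph_def strongly_regular_def)
  then have v: "v > 0"
    using zero_less_card_finite[where 'a='v] by simp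
  have SS: "seidel_matrix adj ** seidel_matrix adj = M"
    using conference_seidel_square[OF assms] by (simp add: M_def)
  have "(\<Sum>z\<in>UNIV. (real v * of_bool (x = z) - 1) * (real v * of_bool (z = y) - 1))
      = real v * (real v * of_bool (x = y) - 1)" for x y :: 'v
  proof -
    have "(real v * of_bool (x = z) - 1) * (real v * of_bool (z = y) - 1)
       = real v * real v * of_bool (x = y) * of_bool (z = x) - real v * of_bool (z = x)
         - real v * of_bool (z = y) + 1" for z
      by (auto simp: algebra_simps)
    \<comment> \<open>The constant \<open>1\<close> sums to \<open>CARD('v) = v\<close> and cancels
      one of the two contributions \<open>- real v\<close>.\<close>
    then show ?thesis
      by (simp add: sum.distrib sum_subtractf card algebra_simps flip: sum_distrib_left)
  qed
  then have MM: "M ** M = real v *\<^sub>R M"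
    by (simp add: M_def matrix_matrix_mult_def vec_eq_iff)
  have trM: "transpose M = M"
    by (auto simp: M_def transpose_def vec_eq_iff)
  have PP: "P ** P = M"
    using v by (simp add: P_def MM matrix_scalar_ac flip: scalar_matrix_assoc)
  have "P ** P = sqrt v *\<^sub>R P"
    using v by (simp add: PP) (simp add: P_def)
  moreover have "transpose P = P"
    using trM by (simp add: P_def transpose_scalar)
  ultimately have "pos_semidef P"
    using v by (intro pos_semidef_if_square_eq_scaleR) auto
  \<comment> \<open>The root is a scalar multiple of its own square \<open>M\<close>, so whatever
    commutes with \<open>M\<close> commutes with it.\<close>
  moreover have "Q ** M = M ** Q \<Longrightarrow> Q ** P = P ** Q" for Q
    by (simp add: P_def matrix_scalar_ac flip: scalar_matrix_assoc)
  ultimately have "matrix_abs (seidel_matrix adj) = P"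
    using matrix_abs_eqI[of P "seidel_matrix adj"] by (simp add: PP SS)
  then show ?thesis
    by (simp add: vertex_seidel_energy_def P_def M_def)
qed

end
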